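(* Let $G$ be a finite group acting transitively on a finite set $\Omega$ with $|\Omega|\geq 2$, let $X$ be a probability distribution over $G$ and let $Y$ be a probability distribution over $\Omega$. Then $$\Vert X\ast_c Y - U_\Omega \Vert \leq \sqrt{|G|/d_H}\cdot \Vert X-U_G\Vert\cdot \Vert Y-U_\Omega\Vert,$$ where $U_G$ (resp. $U_\Omega$) is the uniform probability distribution on $G$ (resp. on $\Omega$).
   Context: Group actions are written on the left. $H=\mathrm{Stab}_G(\omega)$ is the stabilizer in $G$ of some element $\omega\in\Omega$; $1_H^G$ is the (complex) permutation representation of $G$ on the left cosets of $H$ (equivalently, on $\Omega$), i.e. the representation of $G$ induced from the trivial representation of $H$. $d_H$ is the minimum degree (dimension) of a non-trivial irreducible component of $1_H^G$ (such a component exists as $|\Omega|\geq 2$). A probability distribution over a finite set $\Lambda$ is a function $Z:\Lambda\to\mathbb{R}$ with $\sum_{\lambda\in\Lambda}Z(\lambda)=1$. The uniform one takes the constant value $1/|\Lambda|$. The norm of $Z:\Lambda\to\mathbb{R}$ is $\|Z\|=\left(\sum_{\lambda\in\Lambda}Z(\lambda)^2\right)^{1/2}$. For $X:G\to\mathbb{R}$ and $Y:\Omega\to\mathbb{R}$, the convolution $X\ast_c Y:\Omega\to\mathbb{R}$ is $(X\ast_c Y)(\omega)=\sum_{g\in G}X(g)Y(g^{-1}\omega)$. *)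

theory Defs
  imports
    "HOL-Analysis.Analysis"
    "HOL-Library.Function_Algebras"
    "HOL-Algebra.Group_Action"
    "HOL-Algebra.Left_Coset"
begin

section \<open>Complex-valued functions as a complex vector space\<close>

definition cscale :: "complex \<Rightarrow> ('x \<Rightarrow> complex) \<Rightarrow> 'x \<Rightarrow> complex" where
  "cscale c f = (\<lambda>x. c * f x)"

global_interpretation cfun: vector_space cscale
  by unfold_locales (auto simp: cscale_def fun_eq_iff algebra_simps)

section \<open>Permutation representations\<close>

text \<open>A complex function on \<open>E\<close> is represented by its extension by zero, so that
  \<open>fun_space E\<close> is a copy of the space of all functions from \<open>E\<close> to the complex numbers.\<close>

definition fun_space :: "'x set \<Rightarrow> ('x \<Rightarrow> complex) set" where
  "fun_space E = {f. \<forall>x. x \<notin> E \<longrightarrow> f x = 0}"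

definition perm_rep ::
  "('g, 'm) monoid_scheme \<Rightarrow> 'x set \<Rightarrow> ('g \<Rightarrow> 'x \<Rightarrow> 'x) \<Rightarrow> 'g \<Rightarrow> ('x \<Rightarrow> complex) \<Rightarrow> 'x \<Rightarrow> complex"
  where "perm_rep G E \<phi> g f = (\<lambda>x. if x \<in> E then f (\<phi> (inv\<^bsub>G\<^esub> g) x) else 0)"

text \<open>In the next three definitions \<open>\<rho>\<close> is an action of \<open>G\<close> by linear maps on a space of
  complex functions.\<close>

definition subrepresentation ::
  "('g, 'm) monoid_scheme \<Rightarrow> ('g \<Rightarrow> ('x \<Rightarrow> complex) \<Rightarrow> 'x \<Rightarrow> complex) \<Rightarrow>
    ('x \<Rightarrow> complex) set \<Rightarrow> ('x \<Rightarrow> complex) set \<Rightarrow> bool"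
  where "subrepresentation G \<rho> V W \<longleftrightarrow>
    cfun.subspace W \<and> W \<subseteq> V \<and> (\<forall>g\<in>carrier G. \<forall>f\<in>W. \<rho> g f \<in> W)"

definition irreducible_component ::
  "('g, 'm) monoid_scheme \<Rightarrow> ('g \<Rightarrow> ('x \<Rightarrow> complex) \<Rightarrow> 'x \<Rightarrow> complex) \<Rightarrow>
    ('x \<Rightarrow> complex) set \<Rightarrow> ('x \<Rightarrow> complex) set \<Rightarrow> bool"
  where "irreducible_component G \<rho> V W \<longleftrightarrow>
    subrepresentation G \<rho> V W \<and> W \<noteq> {0} \<and>
    (\<forall>U. subrepresentation G \<rho> W U \<longrightarrow> U = {0} \<or> U = W)"

definition trivial_rep ::
  "('g, 'm) monoid_scheme \<Rightarrow> ('g \<Rightarrow> ('x \<Rightarrow> complex) \<Rightarrow> 'x \<Rightarrow> complex) \<Rightarrow>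
    ('x \<Rightarrow> complex) set \<Rightarrow> bool"
  where "trivial_rep G \<rho> W \<longleftrightarrow> (\<forall>g\<in>carrier G. \<forall>f\<in>W. \<rho> g f = f)"

text \<open>The representation of \<open>G\<close> induced from the trivial representation of \<open>H\<close>, realised as the
  permutation representation on the left cosets of \<open>H\<close>, on which \<open>G\<close> acts by left
  multiplication.\<close>

abbreviation coset_rep ::
  "('g, 'm) monoid_scheme \<Rightarrow> 'g set \<Rightarrow> 'g \<Rightarrow> ('g set \<Rightarrow> complex) \<Rightarrow> 'g set \<Rightarrow> complex"
  where "coset_rep G H \<equiv> perm_rep G (lcosets\<^bsub>G\<^esub> H) (\<lambda>g C. g <#\<^bsub>G\<^esub> C)"

text \<open>The irreducible components are taken as irreducible subrepresentations; up to isomorphism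
  these are exactly the irreducible constituents, by complete reducibility. The minimum is
  meaningful whenever \<open>G\<close> is finite and \<open>H\<close> is a proper subgroup.\<close>

definition min_nontrivial_degree :: "('g, 'm) monoid_scheme \<Rightarrow> 'g set \<Rightarrow> nat" where
  "min_nontrivial_degree G H =
    (LEAST d. \<exists>W. irreducible_component G (coset_rep G H) (fun_space (lcosets\<^bsub>G\<^esub> H)) W \<and>
                  \<not> trivial_rep G (coset_rep G H) W \<and> d = cfun.dim W)"

section \<open>Distributions and convolution\<close>

text \<open>Values of a distribution may be negative: only the total mass is prescribed.\<close>

definition prob_distribution :: "'x set \<Rightarrow> ('x \<Rightarrow> real) \<Rightarrow> bool" where
  "prob_distribution \<Lambda> Z \<longleftrightarrow> (\<Sum>x\<in>\<Lambda>. Z x) = 1"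

definition uniform_distribution :: "'x set \<Rightarrow> 'x \<Rightarrow> real" where
  "uniform_distribution \<Lambda> = (\<lambda>_. 1 / real (card \<Lambda>))"

definition act_convolution ::
  "('g, 'm) monoid_scheme \<Rightarrow> ('g \<Rightarrow> 'x \<Rightarrow> 'x) \<Rightarrow> ('g \<Rightarrow> real) \<Rightarrow> ('x \<Rightarrow> real) \<Rightarrow> 'x \<Rightarrow> real"
  where "act_convolution G \<phi> X Y = (\<lambda>x. \<Sum>g\<in>carrier G. X g * Y (\<phi> (inv\<^bsub>G\<^esub> g) x))"

end

theory Submission
  imports Defs
begin

text \<open>Subtracting the uniform distributions reduces the claim to the convolution \<open>T = X * u\<close>
  with \<open>u\<close> of total mass zero. Let \<open>\<rho>\<close> be the permutation representation and
  \<open>q(v) = (\<Sum>g. \<bar>\<langle>\<rho> g u, v\<rangle>\<bar>\<^sup>2)\<close>. If \<open>\<mu>\<close> is the maximum of \<open>q\<close> on the unit sphere, then the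
  vectors with \<open>q(v) = \<mu>\<parallel>v\<parallel>\<^sup>2\<close> form an invariant subspace without non-zero constants, so it
  contains a non-trivial irreducible \<open>W\<close>. Summing \<open>q\<close> over an orthonormal basis of \<open>W\<close>, Bessel's
  inequality gives \<open>\<mu> dim W \<le> \<bar>G\<bar> \<parallel>u\<parallel>\<^sup>2\<close>. Finally Cauchy--Schwarz over the group, applied to
  \<open>\<parallel>T\<parallel>\<^sup>2 = (\<Sum>g. X g \<langle>\<rho> g u, T\<rangle>)\<close>, yields \<open>\<parallel>T\<parallel>\<^sup>2 \<le> \<mu> \<parallel>X\<parallel>\<^sup>2\<close>.\<close>

section \<open>Hermitian form on functions\<close>

definition herm :: "'x set \<Rightarrow> ('x \<Rightarrow> complex) \<Rightarrow> ('x \<Rightarrow> complex) \<Rightarrow> complex" where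
  "herm E f h = (\<Sum>x\<in>E. f x * cnj (h x))"

definition sqnorm :: "'x set \<Rightarrow> ('x \<Rightarrow> complex) \<Rightarrow> real" where
  "sqnorm E f = (\<Sum>x\<in>E. (cmod (f x))\<^sup>2)"

definition orthonormal :: "'x set \<Rightarrow> ('x \<Rightarrow> complex) set \<Rightarrow> bool" where
  "orthonormal E B \<longleftrightarrow> (\<forall>b\<in>B. \<forall>c\<in>B. herm E b c = (if b = c then 1 else 0))"

lemma herm_self: "herm E f f = of_real (sqnorm E f)"
  by (simp add: herm_def sqnorm_def complex_norm_square del: of_real_power)

lemma herm_add_left: "herm E (f + f') h = herm E f h + herm E f' h"
  by (simp add: herm_def algebra_simps sum.distrib)

lemma herm_diff_left: "herm E (f - f') h = herm E f h - herm E f' h"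
  by (simp add: herm_def algebra_simps sum_subtractf)

lemma herm_add_right: "herm E f (h + h') = herm E f h + herm E f h'"
  by (simp add: herm_def algebra_simps sum.distrib)

lemma herm_diff_right: "herm E f (h - h') = herm E f h - herm E f h'"
  by (simp add: herm_def algebra_simps sum_subtractf)

lemma herm_cscale_left: "herm E (cscale c f) h = c * herm E f h"
  by (simp add: herm_def cscale_def sum_distrib_left mult_ac)

lemma herm_cscale_right: "herm E f (cscale c h) = cnj c * herm E f h"
  by (simp add: herm_def cscale_def sum_distrib_left mult_ac)

lemma herm_commute: "herm E h f = cnj (herm E f h)"
  by (simp add: herm_def mult.commute)

lemma sqnorm_nonneg: "sqnorm E f \<ge> 0"
  by (simp add: sqnorm_def sum_nonneg)

lemma sqnorm_eq_0:
  assumes "finite E" "f \<in> fun_space E"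
  shows "sqnorm E f = 0 \<longleftrightarrow> f = 0"
  using assms by (auto simp: sqnorm_def fun_space_def sum_nonneg_eq_0_iff fun_eq_iff)

lemma sqnorm_cscale: "sqnorm E (cscale c f) = (cmod c)\<^sup>2 * sqnorm E f"
  by (simp add: sqnorm_def cscale_def norm_mult power_mult_distrib sum_distrib_left)

lemma cmod_parallelogram:
  "(cmod (a + b))\<^sup>2 + (cmod (a - b))\<^sup>2 = 2 * (cmod a)\<^sup>2 + 2 * (cmod b)\<^sup>2"
  unfolding cmod_power2 by (simp add: power2_eq_square algebra_simps)

lemma sqnorm_parallelogram:
  "sqnorm E (f + h) + sqnorm E (f - h) = 2 * sqnorm E f + 2 * sqnorm E h"
  by (simp add: sqnorm_def sum.distrib[symmetric] sum_distrib_left cmod_parallelogram)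

section \<open>Finite-dimensionality of the space of functions on a finite set\<close>

lemma subspace_fun_space: "cfun.subspace (fun_space E)"
  by (auto simp: cfun.subspace_def fun_space_def cscale_def)

text \<open>Adjoin the indicator of one point at a time. The point type may be infinite, so the
  ambient space of all functions may be infinite-dimensional; this spanning set is what makes
  \<open>cfun.dim\<close> meaningful on subspaces of \<open>fun_space E\<close>.\<close>

lemma fun_space_span:
  assumes "finite E"
  shows "\<exists>B. finite B \<and> fun_space E \<subseteq> cfun.span B"
  using assms
proof (induction E rule: finite_induct)
  case empty
  have "fun_space {} \<subseteq> cfun.span ({} :: ('x \<Rightarrow> complex) set)"
    by (auto simp: fun_space_def fun_eq_iff)
  then show ?case by blast
next
  case (insert x F)
  then obtain B where B: "finite B" "fun_space F \<subseteq> cfun.span B" by blast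
  define \<delta> where "\<delta> = (\<lambda>y. if y = x then 1 else 0 :: complex)"
  have "f \<in> cfun.span (insert \<delta> B)" if "f \<in> fun_space (insert x F)" for f
  proof -
    have "f - cscale (f x) \<delta> \<in> fun_space F"
      using that by (auto simp: fun_space_def \<delta>_def cscale_def)
    then show ?thesis
      using B by (auto simp: cfun.span_insert)
  qed
  then show ?case using B(1) by (intro exI[of _ "insert \<delta> B"]) auto
qed

lemma fun_space_basis:
  assumes "finite E" "W \<subseteq> fun_space E"
  obtains B where "finite B" "B \<subseteq> W" "cfun.independent B" "W \<subseteq> cfun.span B" "card B = cfun.dim W"
proof -
  obtain S where S: "finite S" "fun_space E \<subseteq> cfun.span S"
    using fun_space_span[OF assms(1)] by blast
  obtain B where B: "B \<subseteq> W" "cfun.independent B" "W \<subseteq> cfun.span B" "card B = cfun.dim W"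
    using cfun.basis_exists by blast
  have "finite B"
    using cfun.independent_span_bound[OF S(1) B(2)] B(1) S(2) assms(2) by blast
  with B that show thesis by blast
qed

lemma dim_pos:
  assumes "finite E" "W \<subseteq> fun_space E" "0 \<in> W" "W \<noteq> {0}"
  shows "cfun.dim W > 0"
proof (rule ccontr)
  assume "\<not> cfun.dim W > 0"
  then obtain B where "finite B" "W \<subseteq> cfun.span B" "card B = 0"
    using fun_space_basis[OF assms(1,2)] by (metis gr0I)
  then have "W \<subseteq> {0}" by auto
  with assms show False by auto
qed

text \<open>A basis of \<open>U\<close> stays independent after adding a vector of \<open>W\<close>
  outside \<open>U\<close>, and independent sets in \<open>W\<close> are no larger than a basis of
  \<open>W\<close>.\<close>

lemma dim_less:
  assumes "finite E" "W \<subseteq> fun_space E" "cfun.subspace U" "U \<subset> W"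
  shows "cfun.dim U < cfun.dim W"
proof -
  obtain B where B: "finite B" "B \<subseteq> W" "W \<subseteq> cfun.span B" "card B = cfun.dim W"
    using fun_space_basis[OF assms(1,2)] by metis
  obtain C where C: "finite C" "C \<subseteq> U" "cfun.independent C" "card C = cfun.dim U"
    using fun_space_basis[OF assms(1), of U] assms(2,4) by (metis order_trans psubset_imp_subset)
  obtain w where w: "w \<in> W" "w \<notin> U" using assms(4) by blast
  have wC: "w \<notin> cfun.span C"
    using cfun.span_minimal[OF C(2) assms(3)] w(2) by blast
  then have "w \<notin> C" using cfun.span_base by blast
  have "card (insert w C) \<le> card B"
    using cfun.independent_span_bound[OF B(1) cfun.independent_insertI[OF wC C(3)]]
      B(3) C(2) w(1) assms(4) by blast
  then show ?thesis using \<open>w \<notin> C\<close> C B by simp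
qed

section \<open>Orthonormal families and Gram-Schmidt\<close>

text \<open>Induction on \<open>B\<close>: removing the component of \<open>f\<close> along
  \<open>e\<close> lowers the squared norm by exactly the squared modulus of that coefficient and
  leaves the coefficients against the other vectors unchanged.\<close>

lemma bessel:
  assumes "finite B" "orthonormal E B"
  shows "(\<Sum>b\<in>B. (cmod (herm E f b))\<^sup>2) \<le> sqnorm E f"
  using assms
proof (induction B arbitrary: f rule: finite_induct)
  case empty
  then show ?case by (simp add: sqnorm_nonneg)
next
  case (insert e B)
  define c where "c = herm E f e"
  define f' where "f' = f - cscale c e"
  have on: "orthonormal E B" using insert.prems by (simp add: orthonormal_def)
  have eb: "herm E e b = 0" if "b \<in> B" for b
    using insert.prems insert.hyps(2) that by (auto simp: orthonormal_def)
  have ee: "herm E e e = 1" using insert.prems by (simp add: orthonormal_def)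
  have "of_real (sqnorm E f') = herm E f f - c * cnj c"
    using ee by (simp add: herm_self[symmetric] f'_def herm_diff_left herm_diff_right
        herm_cscale_left herm_cscale_right herm_commute[of E e f] c_def)
  then have "complex_of_real (sqnorm E f') = of_real (sqnorm E f - (cmod c)\<^sup>2)"
    by (simp add: herm_self complex_norm_square del: of_real_power)
  then have "sqnorm E f' = sqnorm E f - (cmod c)\<^sup>2"
    using of_real_eq_iff by blast
  moreover have "herm E f' b = herm E f b" if "b \<in> B" for b
    using eb[OF that] by (simp add: f'_def herm_diff_left herm_cscale_left)
  ultimately show ?case
    using insert.IH[OF on, of f'] insert.hyps by (simp add: c_def)
qed

text \<open>The vector \<open>s\<close> is the orthogonal projection of \<open>w\<close> to the
  span, built up by adding one coefficient at a time.\<close>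

lemma orthogonal_residual:
  assumes "finite B" "orthonormal E B"
  shows "\<exists>s\<in>cfun.span B. \<forall>b\<in>B. herm E (w - s) b = 0"
  using assms
proof (induction B rule: finite_induct)
  case empty
  then show ?case by auto
next
  case (insert e B)
  have on: "orthonormal E B" using insert.prems by (simp add: orthonormal_def)
  have eb: "herm E e b = 0" if "b \<in> B" for b
    using insert.prems insert.hyps(2) that by (auto simp: orthonormal_def)
  have ee: "herm E e e = 1" using insert.prems by (simp add: orthonormal_def)
  obtain s where s: "s \<in> cfun.span B" "\<forall>b\<in>B. herm E (w - s) b = 0"
    using insert.IH[OF on] by blast
  define s' where "s' = s + cscale (herm E (w - s) e) e"
  have "s' \<in> cfun.span (insert e B)"
    unfolding s'_def using s(1)
    by (intro cfun.span_add cfun.span_scale)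
      (auto intro: cfun.span_base cfun.span_mono[THEN subsetD, of B])
  moreover have "herm E (w - s') b = 0" if "b \<in> insert e B" for b
  proof -
    have "herm E (w - s') b = herm E (w - s) b - herm E (w - s) e * herm E e b"
      by (simp add: s'_def herm_diff_left herm_add_left herm_cscale_left)
    with that s(2) ee eb show ?thesis by auto
  qed
  ultimately show ?case by blast
qed

text \<open>Gram-Schmidt: fewer than \<open>cfun.dim W\<close> vectors cannot span \<open>W\<close>,
  so some \<open>w\<close> in \<open>W\<close> has a non-zero residual, which is then
  normalised.\<close>

lemma orthonormal_family:
  assumes "finite E" "W \<subseteq> fun_space E" "cfun.subspace W" "n \<le> cfun.dim W"
  shows "\<exists>B. finite B \<and> card B = n \<and> B \<subseteq> W \<and> orthonormal E B"
  using assms(4)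
proof (induction n)
  case 0
  show ?case by (intro exI[of _ "{}"]) (simp add: orthonormal_def)
next
  case (Suc n)
  then obtain B where B: "finite B" "card B = n" "B \<subseteq> W" "orthonormal E B" by auto
  have "\<not> W \<subseteq> cfun.span B"
    using cfun.dim_le_card[of W B] B Suc.prems by auto
  then obtain w where w: "w \<in> W" "w \<notin> cfun.span B" by blast
  obtain s where s: "s \<in> cfun.span B" "\<forall>b\<in>B. herm E (w - s) b = 0"
    using orthogonal_residual[OF B(1,4)] by blast
  define r where "r = w - s"
  have rW: "r \<in> W"
    using s(1) cfun.span_minimal[OF B(3) assms(3)] w(1) assms(3)
    by (auto simp: r_def intro: cfun.subspace_diff)
  have "r \<noteq> 0" using w(2) s(1) by (auto simp: r_def)
  then have pos: "sqnorm E r > 0"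
    using sqnorm_eq_0[OF assms(1), of r] rW assms(2) sqnorm_nonneg[of E r] by fastforce
  define e where "e = cscale (of_real (1 / sqrt (sqnorm E r))) r"
  have "sqnorm E e = 1"
    using pos by (simp add: e_def sqnorm_cscale norm_divide power_divide)
  then have ee: "herm E e e = 1" by (simp add: herm_self)
  have eb: "herm E e b = 0" if "b \<in> B" for b
    using s(2) that by (simp add: e_def herm_cscale_left r_def)
  have be: "herm E b e = 0" if "b \<in> B" for b
    using eb[OF that] herm_commute[of E b e] by simp
  have "e \<notin> B" using ee eb by force
  have "e \<in> W" unfolding e_def using rW assms(3) by (rule cfun.subspace_scale[rotated])
  have "orthonormal E (insert e B)"
    using B(4) ee eb be \<open>e \<notin> B\<close> by (auto simp: orthonormal_def)
  then show ?case
    using B \<open>e \<notin> B\<close> \<open>e \<in> W\<close> by (intro exI[of _ "insert e B"]) auto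
qed

text \<open>In the product topology on functions the sphere is a closed subset of a product of
  closed unit discs over \<open>E\<close> and singletons elsewhere, which is compact by
  Tychonoff.\<close>

lemma compact_unit_sphere:
  assumes "finite E"
  shows "compact {f \<in> fun_space E. sqnorm E f = 1}"
proof -
  define K where "K = (\<Pi>\<^sub>E x\<in>UNIV. if x \<in> E then cball 0 1 else {0 :: complex})"
  have "compactin (product_topology (\<lambda>_. euclidean) UNIV) K"
    unfolding K_def by (subst compactin_PiE) auto
  then have "compact K" by (simp add: euclidean_product_topology)
  moreover have "closed {f. sqnorm E f = 1}"
    unfolding sqnorm_def by (intro closed_Collect_eq continuous_intros) simp_all
  ultimately have "compact (K \<inter> {f. sqnorm E f = 1})" by (rule compact_Int_closed)
  moreover have "cmod (f x) \<le> 1" if "sqnorm E f = 1" "x \<in> E" for f x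
  proof -
    have "(cmod (f x))\<^sup>2 \<le> sqnorm E f"
      unfolding sqnorm_def using that(2) assms by (intro member_le_sum) auto
    then show ?thesis using that(1) by (simp add: power_le_one_iff abs_square_le_1)
  qed
  then have "K \<inter> {f. sqnorm E f = 1} = {f \<in> fun_space E. sqnorm E f = 1}"
    by (fastforce simp: K_def fun_space_def PiE_iff split: if_splits)
  ultimately show ?thesis by simp
qed

section \<open>Finite transitive actions\<close>

text \<open>The laws are imposed on points of \<open>E\<close> only. The maps of
  \<open>transitive_action\<close> are extensional, which left multiplication of cosets is not, and
  that action has to be an instance.\<close>

locale finite_transitive = group G for G (structure) +
  fixes E :: "'x set" and \<phi> :: "'a \<Rightarrow> 'x \<Rightarrow> 'x"
  assumes finite_carrier: "finite (carrier G)"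
    and finite_points: "finite E"
    and act_closed: "g \<in> carrier G \<Longrightarrow> x \<in> E \<Longrightarrow> \<phi> g x \<in> E"
    and act_one: "x \<in> E \<Longrightarrow> \<phi> \<one> x = x"
    and act_mult: "g \<in> carrier G \<Longrightarrow> h \<in> carrier G \<Longrightarrow> x \<in> E \<Longrightarrow> \<phi> (g \<otimes> h) x = \<phi> g (\<phi> h x)"
    and act_transitive: "x \<in> E \<Longrightarrow> y \<in> E \<Longrightarrow> \<exists>g\<in>carrier G. \<phi> g x = y"
begin

abbreviation "\<rho> \<equiv> perm_rep G E \<phi>"

lemma act_bij: "g \<in> carrier G \<Longrightarrow> bij_betw (\<phi> g) E E"
  by (rule bij_betwI[where g = "\<phi> (inv g)"])
    (auto simp: act_closed act_mult[symmetric] act_one)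

lemma sum_act: "g \<in> carrier G \<Longrightarrow> (\<Sum>x\<in>E. f (\<phi> g x)) = (\<Sum>x\<in>E. f x)"
  by (rule sum.reindex_bij_betw[OF act_bij])

lemma mult_bij: "h \<in> carrier G \<Longrightarrow> bij_betw (\<lambda>g. h \<otimes> g) (carrier G) (carrier G)"
  by (rule bij_betwI[where g = "\<lambda>g. inv h \<otimes> g"]) (auto simp: m_assoc[symmetric])

lemma perm_rep_mult:
  "g \<in> carrier G \<Longrightarrow> h \<in> carrier G \<Longrightarrow> \<rho> (g \<otimes> h) f = \<rho> g (\<rho> h f)"
  by (auto simp: perm_rep_def fun_eq_iff act_closed act_mult inv_mult_group)

lemma perm_rep_one: "f \<in> fun_space E \<Longrightarrow> \<rho> \<one> f = f"
  by (auto simp: perm_rep_def fun_eq_iff act_one fun_space_def)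

lemma perm_rep_closed: "\<rho> g f \<in> fun_space E"
  by (simp add: perm_rep_def fun_space_def)

lemma herm_perm_rep: "g \<in> carrier G \<Longrightarrow> herm E (\<rho> g f) (\<rho> g h) = herm E f h"
  using sum_act[of "inv g" "\<lambda>x. f x * cnj (h x)"] by (simp add: herm_def perm_rep_def)

lemma sqnorm_perm_rep: "g \<in> carrier G \<Longrightarrow> sqnorm E (\<rho> g f) = sqnorm E f"
  using sum_act[of "inv g" "\<lambda>x. (cmod (f x))\<^sup>2"] by (simp add: sqnorm_def perm_rep_def)

section \<open>The quadratic form attached to the orbit of a vector\<close>

text \<open>As a function of \<open>v\<close>, this is the quadratic form of the frame operator of
  the orbit of \<open>u\<close>. That operator is positive semidefinite and commutes with the group;
  it is never constructed.\<close>

definition orbit_form :: "('x \<Rightarrow> complex) \<Rightarrow> ('x \<Rightarrow> complex) \<Rightarrow> real" where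
  "orbit_form u v = (\<Sum>g\<in>carrier G. (cmod (herm E (\<rho> g u) v))\<^sup>2)"

lemma orbit_form_cscale: "orbit_form u (cscale c v) = (cmod c)\<^sup>2 * orbit_form u v"
  by (simp add: orbit_form_def herm_cscale_right norm_mult power_mult_distrib sum_distrib_left)

lemma orbit_form_parallelogram:
  "orbit_form u (v + w) + orbit_form u (v - w) = 2 * orbit_form u v + 2 * orbit_form u w"
  by (simp add: orbit_form_def sum.distrib[symmetric] sum_distrib_left cmod_parallelogram
      herm_add_right herm_diff_right)

text \<open>Since \<open>\<rho> h\<close> is unitary, moving \<open>v\<close> by \<open>h\<close>
  only permutes the terms through the reindexing of \<open>g\<close> as
  \<open>h \<otimes> g\<close>.\<close>

lemma orbit_form_perm_rep:
  assumes "h \<in> carrier G"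
  shows "orbit_form u (\<rho> h v) = orbit_form u v"
proof -
  have "orbit_form u (\<rho> h v) = (\<Sum>g\<in>carrier G. (cmod (herm E (\<rho> (h \<otimes> g) u) (\<rho> h v)))\<^sup>2)"
    unfolding orbit_form_def by (rule sum.reindex_bij_betw[OF mult_bij[OF assms], symmetric])
  also have "\<dots> = orbit_form u v"
    unfolding orbit_form_def using assms by (simp add: perm_rep_mult herm_perm_rep)
  finally show ?thesis .
qed

lemma orbit_form_maximum:
  assumes "u \<in> fun_space E" "u \<noteq> 0"
  obtains \<mu> v where "\<mu> > 0" "v \<in> fun_space E" "v \<noteq> 0" "orbit_form u v = \<mu> * sqnorm E v"
    "\<And>w. w \<in> fun_space E \<Longrightarrow> orbit_form u w \<le> \<mu> * sqnorm E w"
proof -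
  define S where "S = {f \<in> fun_space E. sqnorm E f = 1}"
  have normalise: "cscale (of_real (1 / sqrt (sqnorm E w))) w \<in> S"
    if "w \<in> fun_space E" "w \<noteq> 0" for w
  proof -
    have "sqnorm E w > 0"
      using sqnorm_eq_0[OF finite_points that(1)] that(2) sqnorm_nonneg[of E w] by linarith
    then show ?thesis
      using cfun.subspace_scale[OF subspace_fun_space that(1)]
      by (simp add: S_def sqnorm_cscale norm_divide power_divide)
  qed
  have "continuous_on S (orbit_form u)"
    unfolding orbit_form_def herm_def
    by (rule continuous_on_subset[OF _ subset_UNIV]) (intro continuous_intros, simp_all)
  moreover have "S \<noteq> {}" using normalise[OF assms] by blast
  ultimately obtain v where v: "v \<in> S" and max: "\<And>w. w \<in> S \<Longrightarrow> orbit_form u w \<le> orbit_form u v"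
    using continuous_attains_sup[of S "orbit_form u"] compact_unit_sphere[OF finite_points]
    unfolding S_def by blast
  define \<mu> where "\<mu> = orbit_form u v"
  have upper: "orbit_form u w \<le> \<mu> * sqnorm E w" if w: "w \<in> fun_space E" for w
  proof (cases "w = 0")
    case True
    then show ?thesis by (simp add: orbit_form_def herm_def sqnorm_def)
  next
    case False
    then have "sqnorm E w > 0"
      using sqnorm_eq_0[OF finite_points w] sqnorm_nonneg[of E w] by linarith
    then show ?thesis
      using max[OF normalise[OF w False]]
      by (simp add: \<mu>_def orbit_form_cscale norm_divide power_divide field_simps)
  qed
  have upos: "sqnorm E u > 0"
    using sqnorm_eq_0[OF finite_points assms(1)] assms(2) sqnorm_nonneg[of E u] by linarith
  \<comment> \<open>Positivity of the maximum: the identity contributes the square of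
    \<open>sqnorm E u\<close> to \<open>orbit_form u u\<close>.\<close>
  have "(cmod (herm E (\<rho> \<one> u) u))\<^sup>2 \<le> orbit_form u u"
    unfolding orbit_form_def by (rule member_le_sum) (auto simp: finite_carrier)
  then have "0 < orbit_form u u"
    using upos by (simp add: perm_rep_one[OF assms(1)] herm_self)
      (metis less_le_trans zero_less_power)
  then have "0 < \<mu>"
    using upper[OF assms(1)] upos by (metis less_le_trans zero_less_mult_pos2)
  show thesis
    by (rule that[OF \<open>0 < \<mu>\<close> _ _ _ upper, of v])
      (use v in \<open>auto simp: S_def \<mu>_def sqnorm_def\<close>)
qed

text \<open>A non-zero subrepresentation of least dimension inside \<open>K\<close> is irreducible,
  because a proper subspace has strictly smaller dimension.\<close>

lemma irreducible_exists:
  assumes "subrepresentation G \<rho> (fun_space E) K" "K \<noteq> {0}"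
  shows "\<exists>W\<subseteq>K. irreducible_component G \<rho> (fun_space E) W"
proof -
  define P where "P W \<longleftrightarrow> subrepresentation G \<rho> (fun_space E) W \<and> W \<noteq> {0} \<and> W \<subseteq> K" for W
  have "P K" using assms by (simp add: P_def)
  then obtain W where W: "P W" and min: "\<And>U. P U \<Longrightarrow> cfun.dim W \<le> cfun.dim U"
    using exists_least_iff[of "\<lambda>n. \<exists>W. P W \<and> cfun.dim W = n"] by (metis not_le)
  have "U = W" if U: "subrepresentation G \<rho> W U" "U \<noteq> {0}" for U
  proof (rule ccontr)
    assume "U \<noteq> W"
    then have "U \<subset> W" using U by (auto simp: subrepresentation_def)
    then have "cfun.dim U < cfun.dim W"
      using dim_less[OF finite_points, of W U] W U by (auto simp: P_def subrepresentation_def)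
    moreover have "P U" using W U by (auto simp: P_def subrepresentation_def)
    ultimately show False using min by fastforce
  qed
  then have "irreducible_component G \<rho> (fun_space E) W"
    using W unfolding P_def irreducible_component_def by blast
  then show ?thesis using W by (auto simp: P_def)
qed

text \<open>Every translate of \<open>u\<close> still has sum zero and is thus orthogonal to the
  constants. This is what later excludes the trivial constituent.\<close>

lemma orbit_form_const:
  assumes "(\<Sum>x\<in>E. u x) = 0" "\<And>x y. x \<in> E \<Longrightarrow> y \<in> E \<Longrightarrow> v x = v y"
  shows "orbit_form u v = 0"
proof -
  have "herm E (\<rho> g u) v = 0" if g: "g \<in> carrier G" for g
  proof (cases "E = {}")
    case False
    then obtain c where c: "\<And>x. x \<in> E \<Longrightarrow> v x = c" using assms(2) by (metis all_not_in_conv)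
    have "herm E (\<rho> g u) v = (\<Sum>x\<in>E. u (\<phi> (inv g) x)) * cnj c"
      unfolding herm_def sum_distrib_right
      by (rule sum.cong) (simp_all add: perm_rep_def c)
    then show ?thesis using sum_act[of "inv g" u] g assms(1) by simp
  qed (simp add: herm_def)
  then show ?thesis by (simp add: orbit_form_def)
qed

text \<open>After exchanging the sums, Bessel applies for each \<open>g\<close> separately, and
  \<open>\<rho> g u\<close> has the same norm as \<open>u\<close>.\<close>

lemma orbit_form_trace:
  assumes "finite B" "orthonormal E B"
  shows "(\<Sum>b\<in>B. orbit_form u b) \<le> real (order G) * sqnorm E u"
proof -
  have "(\<Sum>b\<in>B. orbit_form u b) = (\<Sum>g\<in>carrier G. \<Sum>b\<in>B. (cmod (herm E (\<rho> g u) b))\<^sup>2)"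
    unfolding orbit_form_def by (rule sum.swap)
  also have "\<dots> \<le> (\<Sum>g\<in>carrier G. sqnorm E u)"
    using bessel[OF assms] sqnorm_perm_rep by (intro sum_mono) metis
  also have "\<dots> = real (order G) * sqnorm E u" by (simp add: order_def)
  finally show ?thesis .
qed

text \<open>Here \<open>\<mu>\<close> is the top eigenvalue of the frame operator and
  \<open>W\<close> lies in its eigenspace. The form equals \<open>\<mu>\<close> on every unit vector
  of \<open>W\<close>, so the trace bound limits \<open>\<mu>\<close> in terms of the dimension of
  \<open>W\<close>.\<close>

lemma nontrivial_irreducible_orbit_form:
  assumes u: "u \<in> fun_space E" "u \<noteq> 0" "(\<Sum>x\<in>E. u x) = 0"
  obtains W \<mu> where "irreducible_component G \<rho> (fun_space E) W" "\<not> trivial_rep G \<rho> W"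
    "\<mu> > 0" "\<mu> * real (cfun.dim W) \<le> real (order G) * sqnorm E u"
    "\<And>v. v \<in> fun_space E \<Longrightarrow> orbit_form u v \<le> \<mu> * sqnorm E v"
proof -
  obtain \<mu> v0 where lam: "\<mu> > 0" and v0: "v0 \<in> fun_space E" "v0 \<noteq> 0"
      "orbit_form u v0 = \<mu> * sqnorm E v0"
    and upper: "\<And>w. w \<in> fun_space E \<Longrightarrow> orbit_form u w \<le> \<mu> * sqnorm E w"
    using orbit_form_maximum[OF u(1,2)] by metis
  define K where "K = {v \<in> fun_space E. orbit_form u v = \<mu> * sqnorm E v}"
  \<comment> \<open>\<open>K\<close> is the null set of the positive semidefinite form \<open>\<mu>\<parallel>v\<parallel>\<^sup>2 - q(v)\<close>, so closure under
    sums follows from the parallelogram law, without the spectral theorem.\<close>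
  have add: "v + w \<in> K" if "v \<in> K" "w \<in> K" for v w
  proof -
    have fs: "v + w \<in> fun_space E" "v - w \<in> fun_space E"
      using that cfun.subspace_add[OF subspace_fun_space] cfun.subspace_diff[OF subspace_fun_space]
      by (auto simp: K_def)
    have "orbit_form u (v + w) + orbit_form u (v - w)
        = \<mu> * (sqnorm E (v + w) + sqnorm E (v - w))"
      unfolding orbit_form_parallelogram sqnorm_parallelogram
      using that by (simp add: K_def algebra_simps)
    then show ?thesis
      using upper[OF fs(1)] upper[OF fs(2)] fs(1) by (simp add: K_def algebra_simps)
  qed
  have "cfun.subspace K"
    unfolding cfun.subspace_def
  proof (intro conjI ballI allI)
    show "0 \<in> K"
      by (simp add: K_def orbit_form_def herm_def sqnorm_def fun_space_def)
    show "cscale c v \<in> K" if "v \<in> K" for c v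
      using that
      by (auto simp: K_def orbit_form_cscale sqnorm_cscale
          intro: cfun.subspace_scale[OF subspace_fun_space])
  qed (rule add)
  then have "subrepresentation G \<rho> (fun_space E) K"
    by (auto simp: subrepresentation_def K_def perm_rep_closed orbit_form_perm_rep sqnorm_perm_rep)
  moreover have "K \<noteq> {0}" using v0 by (auto simp: K_def)
  ultimately obtain W where W: "W \<subseteq> K" "irreducible_component G \<rho> (fun_space E) W"
    using irreducible_exists by blast
  have Ws: "cfun.subspace W" "W \<noteq> {0}" "W \<subseteq> fun_space E"
    using W(2) by (auto simp: irreducible_component_def subrepresentation_def)
  \<comment> \<open>By transitivity, fixed functions are constant on \<open>E\<close>. The form
    vanishes on them, whereas it is positive on non-zero vectors of \<open>K\<close>.\<close>
  have "\<not> trivial_rep G \<rho> W"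
  proof
    assume triv: "trivial_rep G \<rho> W"
    obtain w where w: "w \<in> W" "w \<noteq> 0" using Ws cfun.subspace_0 by blast
    have "w x = w y" if xy: "x \<in> E" "y \<in> E" for x y
    proof -
      obtain g where g: "g \<in> carrier G" "\<phi> g x = y" using act_transitive[OF xy] by blast
      have "w x = \<rho> (inv g) w x" using triv w(1) g(1) by (simp add: trivial_rep_def)
      also have "\<dots> = w y" using xy g by (simp add: perm_rep_def)
      finally show ?thesis .
    qed
    then have "orbit_form u w = 0" by (intro orbit_form_const u(3))
    moreover have "orbit_form u w = \<mu> * sqnorm E w" using w(1) W(1) by (auto simp: K_def)
    moreover have "sqnorm E w \<noteq> 0"
      using sqnorm_eq_0[OF finite_points] w Ws(3) by blast
    ultimately show False using lam by simp
  qed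
  moreover obtain B where B: "finite B" "card B = cfun.dim W" "B \<subseteq> W" "orthonormal E B"
    using orthonormal_family[OF finite_points Ws(3,1) order_refl] by blast
  have "orbit_form u b = \<mu>" if "b \<in> B" for b
  proof -
    have "complex_of_real (sqnorm E b) = 1"
      using B(4) that by (simp add: orthonormal_def herm_self[symmetric])
    then have "sqnorm E b = 1" using of_real_eq_1_iff by blast
    then show ?thesis using that B(3) W(1) by (auto simp: K_def)
  qed
  then have "\<mu> * real (cfun.dim W) = (\<Sum>b\<in>B. orbit_form u b)"
    using B(2) by (simp add: mult.commute)
  ultimately show thesis
    using that[OF W(2) _ lam _ upper] orbit_form_trace[OF B(1,4), of u] by simp
qed

section \<open>From the maximum of the form to the convolution bound\<close>

text \<open>For the coset action this unfolds to \<open>min_nontrivial_degree\<close>; stating it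
  for any action keeps the analysis independent of cosets.\<close>

definition min_degree :: nat where
  "min_degree = (LEAST d. \<exists>W. irreducible_component G \<rho> (fun_space E) W \<and>
                  \<not> trivial_rep G \<rho> W \<and> d = cfun.dim W)"

lemma orbit_form_bound:
  assumes u: "u \<in> fun_space E" "(\<Sum>x\<in>E. u x) = 0" and v: "v \<in> fun_space E"
  shows "orbit_form u v \<le> real (order G) / real min_degree * sqnorm E u * sqnorm E v"
proof (cases "u = 0")
  \<comment> \<open>The zero vector is separated because the irreducible subspace is supplied only
    for non-zero \<open>u\<close>; here both sides are 0.\<close>
  case True
  then show ?thesis by (simp add: orbit_form_def herm_def perm_rep_def sqnorm_def)
next
  case False
  obtain W \<mu> where W: "irreducible_component G \<rho> (fun_space E) W" "\<not> trivial_rep G \<rho> W"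
    and lam: "\<mu> > 0" "\<mu> * real (cfun.dim W) \<le> real (order G) * sqnorm E u"
    and upper: "orbit_form u v \<le> \<mu> * sqnorm E v"
    using nontrivial_irreducible_orbit_form[OF u(1) False u(2)] v by metis
  let ?D = "\<lambda>d. \<exists>W. irreducible_component G \<rho> (fun_space E) W \<and>
                  \<not> trivial_rep G \<rho> W \<and> d = cfun.dim W"
  have D: "?D (cfun.dim W)" using W by blast
  have "min_degree \<le> cfun.dim W" unfolding min_degree_def by (rule Least_le[of ?D, OF D])
  then have "\<mu> * real min_degree \<le> real (order G) * sqnorm E u"
    using lam by (smt (verit) mult_left_mono of_nat_mono)
  moreover have "?D min_degree" unfolding min_degree_def by (rule LeastI[of ?D, OF D])
  then obtain W' where W': "irreducible_component G \<rho> (fun_space E) W'" "min_degree = cfun.dim W'"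
    by blast
  \<comment> \<open>The least degree is attained by a non-zero subspace. Positivity is essential,
    since division by 0 would give the quotient the value 0.\<close>
  then have "min_degree > 0"
    using dim_pos[OF finite_points, of W'] cfun.subspace_0[of W']
    by (simp add: irreducible_component_def subrepresentation_def)
  ultimately have "\<mu> \<le> real (order G) / real min_degree * sqnorm E u"
    by (simp add: field_simps)
  then show ?thesis
    using upper mult_right_mono[OF _ sqnorm_nonneg[of E v]] by (meson order_trans)
qed

lemma sqnorm_of_real: "sqnorm E (\<lambda>x. if x \<in> E then of_real (f x) else 0) = (L2_set f E)\<^sup>2"
  by (simp add: sqnorm_def L2_set_def sum_nonneg)

lemma convolution_bound:
  assumes "(\<Sum>x\<in>E. Y x) = 0"
  shows "L2_set (act_convolution G \<phi> X Y) E
    \<le> sqrt (real (order G) / real min_degree) * L2_set X (carrier G) * L2_set Y E"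
proof -
  define u where "u = (\<lambda>x. if x \<in> E then complex_of_real (Y x) else 0)"
  define v where "v = (\<lambda>x. if x \<in> E then complex_of_real (act_convolution G \<phi> X Y x) else 0)"
  let ?T = "L2_set (act_convolution G \<phi> X Y) E"
  let ?C = "sqrt (real (order G) / real min_degree)"
  have uv: "u \<in> fun_space E" "v \<in> fun_space E" by (simp_all add: u_def v_def fun_space_def)
  have "(\<Sum>x\<in>E. u x) = of_real (\<Sum>x\<in>E. Y x)" by (simp add: u_def)
  then have "(\<Sum>x\<in>E. u x) = 0" using assms by simp
  then have "orbit_form u v \<le> ?C\<^sup>2 * (L2_set Y E)\<^sup>2 * ?T\<^sup>2"
    using orbit_form_bound[OF uv(1) _ uv(2)] by (simp add: u_def v_def sqnorm_of_real)
  then have "sqrt (orbit_form u v) \<le> sqrt ((?C * L2_set Y E * ?T)\<^sup>2)"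
    by (simp only: power_mult_distrib real_sqrt_le_iff)
  then have q: "sqrt (orbit_form u v) \<le> ?C * L2_set Y E * ?T"
    by simp
  \<comment> \<open>On \<open>E\<close> the convolution is the combination of the translates
    \<open>\<rho> g u\<close> with coefficients \<open>X g\<close>; this is substituted in the first
    argument only.\<close>
  have "herm E v v = (\<Sum>x\<in>E. \<Sum>g\<in>carrier G. of_real (X g) * (\<rho> g u x * cnj (v x)))"
    unfolding herm_def
    by (rule sum.cong)
      (auto simp: v_def u_def act_convolution_def perm_rep_def sum_distrib_right act_closed mult.assoc
        intro!: sum.cong)
  also have "\<dots> = (\<Sum>g\<in>carrier G. of_real (X g) * herm E (\<rho> g u) v)"
    by (subst sum.swap) (simp add: herm_def sum_distrib_left)
  finally have vv: "herm E v v = (\<Sum>g\<in>carrier G. of_real (X g) * herm E (\<rho> g u) v)" .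
  have "?T\<^sup>2 = cmod (herm E v v)"
    unfolding herm_self by (simp add: v_def sqnorm_of_real del: of_real_power)
  also note vv
  also have "cmod (\<Sum>g\<in>carrier G. of_real (X g) * herm E (\<rho> g u) v)
      \<le> (\<Sum>g\<in>carrier G. \<bar>X g\<bar> * \<bar>cmod (herm E (\<rho> g u) v)\<bar>)"
    by (rule order_trans[OF norm_sum]) (simp add: norm_mult)
  also have "\<dots> \<le> L2_set X (carrier G) * L2_set (\<lambda>g. cmod (herm E (\<rho> g u) v)) (carrier G)"
    by (rule L2_set_mult_ineq)
  also have "L2_set (\<lambda>g. cmod (herm E (\<rho> g u) v)) (carrier G) = sqrt (orbit_form u v)"
    by (simp add: L2_set_def orbit_form_def)
  also have "L2_set X (carrier G) * sqrt (orbit_form u v)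
      \<le> L2_set X (carrier G) * (?C * L2_set Y E * ?T)"
    by (rule mult_left_mono[OF q L2_set_nonneg])
  finally have "?T * ?T \<le> (?C * L2_set X (carrier G) * L2_set Y E) * ?T"
    by (simp add: power2_eq_square mult_ac)
  \<comment> \<open>Cancelling one factor \<open>?T\<close> requires it to be positive; if it is 0,
    the bound holds because its right side is non-negative.\<close>
  then have "?T \<le> ?C * L2_set X (carrier G) * L2_set Y E" if "?T > 0"
    using that by (rule mult_right_le_imp_le)
  moreover have "0 \<le> ?C * L2_set X (carrier G) * L2_set Y E"
    by (intro mult_nonneg_nonneg L2_set_nonneg) simp
  ultimately show ?thesis by linarith
qed

section \<open>Subtracting the uniform distributions\<close>

text \<open>By transitivity and reindexing of the group, the inner sum is the same at every point.
  Summing it over all points and exchanging sums evaluates it, as each \<open>g\<close> permutes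
  \<open>E\<close>.\<close>

lemma sum_orbit_average:
  fixes Y :: "'x \<Rightarrow> real"
  assumes "x \<in> E"
  shows "real (card E) * (\<Sum>g\<in>carrier G. Y (\<phi> (inv g) x)) = real (order G) * (\<Sum>y\<in>E. Y y)"
proof -
  define F where "F x = (\<Sum>g\<in>carrier G. Y (\<phi> (inv g) x))" for x
  have "F y = F x" if y: "y \<in> E" for y
  proof -
    obtain h where h: "h \<in> carrier G" "\<phi> h x = y" using act_transitive[OF assms y] by blast
    have "F y = (\<Sum>g\<in>carrier G. Y (\<phi> (inv (h \<otimes> g)) y))"
      unfolding F_def by (rule sum.reindex_bij_betw[OF mult_bij[OF h(1)], symmetric])
    also have "\<dots> = F x"
      unfolding F_def
    proof (rule sum.cong)
      fix g assume g: "g \<in> carrier G"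
      have "\<phi> (inv (h \<otimes> g)) y = \<phi> (inv (h \<otimes> g) \<otimes> h) x"
        using g h assms by (simp add: act_mult)
      also have "inv (h \<otimes> g) \<otimes> h = inv g"
        using g h by (simp add: inv_mult_group m_assoc)
      finally show "Y (\<phi> (inv (h \<otimes> g)) y) = Y (\<phi> (inv g) x)" by simp
    qed simp
    finally show ?thesis .
  qed
  then have "real (card E) * F x = (\<Sum>y\<in>E. F y)" by simp
  also have "\<dots> = (\<Sum>g\<in>carrier G. \<Sum>y\<in>E. Y (\<phi> (inv g) y))"
    unfolding F_def by (rule sum.swap)
  also have "\<dots> = real (order G) * (\<Sum>y\<in>E. Y y)"
    by (simp add: sum_act order_def)
  finally show ?thesis by (simp add: F_def)
qed

text \<open>Expand bilinearly. Each of the three products with at least one uniform factor is the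
  uniform distribution on \<open>E\<close>, so they contribute minus one copy of it in
  total.\<close>

lemma convolution_diff_uniform:
  assumes X: "prob_distribution (carrier G) X" and Y: "prob_distribution E Y" and x: "x \<in> E"
  shows "act_convolution G \<phi> X Y x - uniform_distribution E x =
    act_convolution G \<phi> (\<lambda>g. X g - uniform_distribution (carrier G) g)
      (\<lambda>y. Y y - uniform_distribution E y) x"
proof -
  have G: "real (order G) > 0" using order_gt_0_iff_finite finite_carrier by simp
  have E: "real (card E) > 0" using x finite_points by (simp add: card_gt_0_iff) blast
  have "(\<Sum>g\<in>carrier G. Y (\<phi> (inv g) x)) = real (order G) / real (card E)"
    using sum_orbit_average[OF x, of Y] Y E by (simp add: prob_distribution_def field_simps)
  then show ?thesis
    using X G E
    by (simp add: act_convolution_def uniform_distribution_def prob_distribution_def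
        algebra_simps sum.distrib sum_subtractf sum_distrib_left[symmetric]
        sum_distrib_right[symmetric] sum_divide_distrib[symmetric] order_def[symmetric])
qed

lemma convolution_uniform_bound:
  assumes X: "prob_distribution (carrier G) X" and Y: "prob_distribution E Y" and "E \<noteq> {}"
  shows "L2_set (\<lambda>x. act_convolution G \<phi> X Y x - uniform_distribution E x) E
      \<le> sqrt (real (order G) / real min_degree)
        * L2_set (\<lambda>g. X g - uniform_distribution (carrier G) g) (carrier G)
        * L2_set (\<lambda>x. Y x - uniform_distribution E x) E"
proof -
  have "(\<Sum>y\<in>E. Y y - uniform_distribution E y) = 0"
    using Y assms(3) finite_points
    by (simp add: prob_distribution_def uniform_distribution_def sum_subtractf)
  from convolution_bound[OF this] show ?thesis
    using convolution_diff_uniform[OF X Y] by (simp cong: L2_set_cong)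
qed

end

section \<open>Transfer to cosets of a stabilizer\<close>

context transitive_action
begin

text \<open>The fibre over \<open>x\<close> of the orbit map of \<open>\<omega>\<close>; by
  transitivity these are the left cosets of the stabilizer.\<close>

definition fibre where
  "fibre \<omega> x = {g \<in> carrier G. \<phi> g \<omega> = x}"

lemma fibre_equivariant:
  assumes "\<omega> \<in> E" "x \<in> E" "g \<in> carrier G"
  shows "g <# fibre \<omega> x = fibre \<omega> (\<phi> g x)"
proof -
  interpret group G using group_hom group_hom.axioms(1) by auto
  show ?thesis
  proof
    show "g <# fibre \<omega> x \<subseteq> fibre \<omega> (\<phi> g x)"
      using assms by (auto simp: l_coset_def fibre_def composition_rule)
    show "fibre \<omega> (\<phi> g x) \<subseteq> g <# fibre \<omega> x"
    proof
      fix k assume "k \<in> fibre \<omega> (\<phi> g x)"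
      then have k: "k \<in> carrier G" "\<phi> k \<omega> = \<phi> g x" by (auto simp: fibre_def)
      have "\<phi> (inv g \<otimes> k) \<omega> = x"
        using k assms by (simp add: composition_rule orbit_sym_aux)
      then have "inv g \<otimes> k \<in> fibre \<omega> x" using k assms by (simp add: fibre_def)
      moreover have "k = g \<otimes> (inv g \<otimes> k)" using k assms by (simp add: m_assoc[symmetric])
      ultimately show "k \<in> g <# fibre \<omega> x" by (auto simp: l_coset_def)
    qed
  qed
qed

text \<open>Orbit-stabilizer: the fibre over \<open>\<omega>\<close> is the stabilizer, so
  equivariance turns the other fibres into its cosets. Fibres are non-empty by transitivity, and any
  element of one determines its point.\<close>

lemma fibre_bij:
  assumes "\<omega> \<in> E"
  shows "bij_betw (fibre \<omega>) E (lcosets (stabilizer G \<phi> \<omega>))"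
proof -
  have coset: "fibre \<omega> (\<phi> k \<omega>) = k <# stabilizer G \<phi> \<omega>" if "k \<in> carrier G" for k
    using fibre_equivariant[OF assms assms that] by (simp add: fibre_def stabilizer_def)
  show ?thesis
  proof (rule bij_betw_imageI)
    show "inj_on (fibre \<omega>) E"
      using unique_orbit[OF assms] by (fastforce simp: inj_on_def fibre_def)
    have "fibre \<omega> x \<in> lcosets (stabilizer G \<phi> \<omega>)" if "x \<in> E" for x
      using unique_orbit[OF assms that] coset by (auto simp: LCOSETS_def)
    moreover have "\<phi> k \<omega> \<in> E" if "k \<in> carrier G" for k
      using element_image[OF that assms] by simp
    ultimately show "fibre \<omega> ` E = lcosets (stabilizer G \<phi> \<omega>)"
      using coset by (fastforce simp: LCOSETS_def)
  qed
qed

text \<open>Every coset is a fibre, so equivariance carries each law of the action over from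
  \<open>E\<close>.\<close>

lemma finite_transitive_lcosets:
  assumes "finite (carrier G)" "finite E" "\<omega> \<in> E"
  shows "finite_transitive G (lcosets (stabilizer G \<phi> \<omega>)) (\<lambda>g C. g <# C)"
proof -
  interpret group G using group_hom group_hom.axioms(1) by auto
  have im: "lcosets (stabilizer G \<phi> \<omega>) = fibre \<omega> ` E"
    using fibre_bij[OF assms(3)] by (simp add: bij_betw_def)
  have cl: "\<phi> g x \<in> E" if "g \<in> carrier G" "x \<in> E" for g x
    using element_image[OF that] by simp
  have one: "\<phi> \<one> x = x" if "x \<in> E" for x
    using id_eq_one that by (metis restrict_apply')
  show ?thesis
    unfolding im
  proof unfold_locales
    show "\<exists>g\<in>carrier G. g <# C = D" if "C \<in> fibre \<omega> ` E" "D \<in> fibre \<omega> ` E" for C D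
      using that unique_orbit fibre_equivariant[OF assms(3)] by blast
  qed (use assms cl in \<open>auto simp: fibre_equivariant one composition_rule\<close>)
qed

end

theorem theorem2:
  fixes G :: "('g, 'm) monoid_scheme"
    and \<Omega> :: "'x set"
    and \<phi> :: "'g \<Rightarrow> 'x \<Rightarrow> 'x"
    and X :: "'g \<Rightarrow> real"
    and Y :: "'x \<Rightarrow> real"
    and \<omega> :: 'x
    and H :: "'g set"
  assumes "transitive_action G \<Omega> \<phi>"
    and "finite (carrier G)"
    and "finite \<Omega>"
    and "card \<Omega> \<ge> 2"
    and "\<omega> \<in> \<Omega>"
    and "H = stabilizer G \<phi> \<omega>"
    and "prob_distribution (carrier G) X"
    and "prob_distribution \<Omega> Y"
  shows "L2_set (\<lambda>x. act_convolution G \<phi> X Y x - uniform_distribution \<Omega> x) \<Omega>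
      \<le> sqrt (real (order G) / real (min_nontrivial_degree G H))
        * L2_set (\<lambda>g. X g - uniform_distribution (carrier G) g) (carrier G)
        * L2_set (\<lambda>x. Y x - uniform_distribution \<Omega> x) \<Omega>"
proof -
  interpret transitive_action G \<Omega> \<phi> by fact
  interpret group G using group_hom group_hom.axioms(1) by auto
  let ?L = "lcosets\<^bsub>G\<^esub> H" and ?\<beta> = "fibre \<omega>"
  \<comment> \<open>The degree is defined through the coset representation, so the bound is proved
    on cosets and pulled back along \<open>fibre \<omega>\<close>.\<close>
  interpret C: finite_transitive G ?L "\<lambda>g C. g <#\<^bsub>G\<^esub> C"
    using finite_transitive_lcosets assms by simp
  have bij: "bij_betw ?\<beta> \<Omega> ?L" using fibre_bij assms by simp
  have deg: "C.min_degree = min_nontrivial_degree G H"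
    by (simp add: C.min_degree_def min_nontrivial_degree_def)
  have L2: "L2_set f ?L = L2_set (\<lambda>x. f (?\<beta> x)) \<Omega>" for f
    by (simp add: L2_set_def sum.reindex_bij_betw[OF bij, symmetric])
  have uniform: "uniform_distribution ?L (?\<beta> x) = uniform_distribution \<Omega> x" for x
    using bij_betw_same_card[OF bij] by (simp add: uniform_distribution_def)
  define Y' where "Y' = (\<lambda>C. Y (inv_into \<Omega> ?\<beta> C))"
  have Y': "Y' (?\<beta> x) = Y x" if "x \<in> \<Omega>" for x
    using that bij by (simp add: Y'_def bij_betw_inv_into_left)
  have "prob_distribution ?L Y'"
    using assms(8) by (simp add: prob_distribution_def sum.reindex_bij_betw[OF bij, symmetric] Y')
  \<comment> \<open>Equivariance of the bijection makes convolution commute with the transport of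
    \<open>Y\<close> to \<open>Y'\<close>.\<close>
  moreover have "act_convolution G (\<lambda>g C. g <#\<^bsub>G\<^esub> C) X Y' (?\<beta> x) = act_convolution G \<phi> X Y x"
    if "x \<in> \<Omega>" for x
    unfolding act_convolution_def
    using that assms(5) element_image[OF inv_closed that]
    by (intro sum.cong) (simp_all add: fibre_equivariant Y')
  moreover have "?L \<noteq> {}" using bij assms(5) by (auto simp: bij_betw_def)
  ultimately show ?thesis
    using C.convolution_uniform_bound[OF assms(7), of Y']
    by (simp add: deg L2 uniform Y' cong: L2_set_cong)
qed

end
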